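(* Let $A,C\in M_n(\mathbb{R}_+)$. Then: (i) $W_{\max}^C(\alpha A\oplus\beta I_n)=\alpha W_{\max}^C(A)\oplus\beta\, tr_\otimes(C)$ for all $\alpha,\beta\in\mathbb{R}_+$. (ii) $W_{\max}^C(A\oplus B)\subseteq W_{\max}^C(A)\oplus W_{\max}^C(B)$ and $W_{\max}^{C\oplus D}(A)\subseteq W_{\max}^C(A)\oplus W_{\max}^D(A)$ for all $B,D\in M_n(\mathbb{R}_+)$. (iii) $W_{\max}^C(U^t\otimes A\otimes U)=W_{\max}^C(A)$ for every $U\in\mathcal{U}_n$. (iv) If $C^t=C$, then $W_{\max}^C(A^t)=W_{\max}^C(A)$. (v) If $C=\alpha I_n$ with $\alpha\in\mathbb{R}_+$, then $W_{\max}^C(A)=\{\alpha\, tr_\otimes(A)\}$. (vi) $W_{\max}^C(A)=W_{\max}^A(C)$.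
   Context: $\mathbb{R}_+$ is the set of nonnegative reals and $M_n(\mathbb{R}_+)$ the set of $n\times n$ matrices with nonnegative real entries. Max algebra: $a\oplus b=\max\{a,b\}$, $(A\oplus B)_{ij}=\max\{a_{ij},b_{ij}\}$, $(A\otimes B)_{ij}=\max_l a_{il}b_{lj}$; $tr_\otimes(A)=\max_i a_{ii}$. $I_n$ is the usual identity matrix. $\mathcal{U}_n=\{U\in M_n(\mathbb{R}_+): U^t\otimes U=U\otimes U^t=I_n\}$ (the group of $n\times n$ permutation matrices). For $A,C\in M_n(\mathbb{R}_+)$ the max $C$-numerical range of $A$ is $W_{\max}^C(A)=\{tr_\otimes(C\otimes X^t\otimes A\otimes X): X\in\mathcal{U}_n\}$. For sets $S,T\subseteq\mathbb{R}_+$ and $\alpha,\gamma\in\mathbb{R}_+$: $S\oplus T=\{s\oplus t:s\in S,t\in T\}$, $\alpha S=\{\alpha s:s\in S\}$, $S\oplus\gamma=\{s\oplus\gamma:s\in S\}$. *)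

theory Defs
  imports "HOL-Analysis.Analysis"
begin

definition nonneg_mats :: "(real ^ 'n ^ 'n) set" where
  "nonneg_mats = {A. \<forall>i j. 0 \<le> A $ i $ j}"

definition max_add :: "real ^ 'n ^ 'n \<Rightarrow> real ^ 'n ^ 'n \<Rightarrow> real ^ 'n ^ 'n"
    (infixl "\<oplus>\<^sub>m" 65) where
  "A \<oplus>\<^sub>m B = (\<chi> i j. max (A $ i $ j) (B $ i $ j))"

definition max_mult :: "real ^ 'n ^ 'n \<Rightarrow> real ^ 'n ^ 'n \<Rightarrow> real ^ 'n ^ 'n"
    (infixl "\<otimes>\<^sub>m" 70) where
  "A \<otimes>\<^sub>m B = (\<chi> i j. MAX l. A $ i $ l * B $ l $ j)"

definition max_tr :: "real ^ 'n ^ 'n \<Rightarrow> real" where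
  "max_tr A = (MAX i. A $ i $ i)"

definition max_unitary :: "(real ^ 'n ^ 'n) set" where
  "max_unitary = {U \<in> nonneg_mats.
     transpose U \<otimes>\<^sub>m U = mat 1 \<and> U \<otimes>\<^sub>m transpose U = mat 1}"

text \<open>The first argument is the matrix \<open>C\<close>, the second is \<open>A\<close>.  The product associates to the
  left; on nonnegative matrices it is associative, so the bracketing is immaterial there.\<close>

definition max_num_range :: "real ^ 'n ^ 'n \<Rightarrow> real ^ 'n ^ 'n \<Rightarrow> real set" where
  "max_num_range C A =
     {max_tr (C \<otimes>\<^sub>m transpose X \<otimes>\<^sub>m A \<otimes>\<^sub>m X) | X. X \<in> max_unitary}"

definition set_max :: "real set \<Rightarrow> real set \<Rightarrow> real set" where
  "set_max S T = {max s t | s t. s \<in> S \<and> t \<in> T}"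

definition set_scale :: "real \<Rightarrow> real set \<Rightarrow> real set" where
  "set_scale a S = {a * s | s. s \<in> S}"

definition set_max_scalar :: "real set \<Rightarrow> real \<Rightarrow> real set" where
  "set_max_scalar S c = {max s c | s. s \<in> S}"

end

theory Submission
  imports Defs
begin

text \<open>
  The matrices that are unitary in max algebra are exactly the permutation matrices: a column of
  such a matrix must attain the value \<open>1\<close> of the corresponding diagonal entry of
  \<open>transpose U \<otimes>\<^sub>m U\<close>, and orthogonality of the rows then kills every other entry of that column.
  Conjugating by the matrix of \<open>p\<close> only relabels indices, so that for \<open>X = perm_mat p\<close>
  \<open>max_tr (C \<otimes>\<^sub>m transpose X \<otimes>\<^sub>m A \<otimes>\<^sub>m X) = (MAX (i, j). C $ i $ j * A $ p j $ p i)\<close>.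
  Thus the max \<open>C\<close>-numerical range of \<open>A\<close> is the set of values of the quantity on the right, called
  \<open>perm_pairing C A p\<close> below, over all bijections \<open>p\<close> (\<open>max_num_range_eq_perm_pairing\<close>).

  All six claims become facts about this one maximum. It commutes with binary maxima and with
  nonnegative scaling in \<open>A\<close>; against the identity matrix it only sees the diagonal of \<open>C\<close>,
  whatever \<open>p\<close> is. Swapping \<open>i\<close> and \<open>j\<close> shows that transposing both matrices changes nothing, and
  reindexing by \<open>p\<close> exchanges \<open>C\<close> with \<open>A\<close> at the price of inverting \<open>p\<close>. Conjugating \<open>A\<close> by the
  matrix of \<open>q\<close> replaces \<open>p\<close> by \<open>q \<circ> p\<close>, which again runs through all bijections. A scalar \<open>C\<close> is first
  exchanged with \<open>A\<close>, after which the pairing no longer depends on \<open>p\<close>.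
\<close>

section \<open>Maxima over finite index types\<close>

lemma MAX_upper: "f x \<le> (MAX x. f x)" for f :: "'a::finite \<Rightarrow> real"
  by (rule Max_ge) auto

lemma MAX_least:
  fixes f :: "'a::finite \<Rightarrow> real"
  assumes "\<And>x. f x \<le> c"
  shows "(MAX x. f x) \<le> c"
  using assms by (subst Max_le_iff) auto

lemma MAX_attained:
  fixes f :: "'a::finite \<Rightarrow> real"
  obtains x where "(MAX x. f x) = f x"
proof -
  have "(MAX x. f x) \<in> range f" by (rule Max_in) auto
  then show ?thesis using that by blast
qed

lemma MAX_max:
  fixes f g :: "'a::finite \<Rightarrow> real"
  shows "(MAX x. max (f x) (g x)) = max (MAX x. f x) (MAX x. g x)"
proof (rule antisym)
  show "(MAX x. max (f x) (g x)) \<le> max (MAX x. f x) (MAX x. g x)"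
    by (rule MAX_least) (meson MAX_upper max.mono)
next
  have "f x \<le> (MAX x. max (f x) (g x))" "g x \<le> (MAX x. max (f x) (g x))" for x
    using MAX_upper[of "\<lambda>x. max (f x) (g x)" x] by simp_all
  then show "max (MAX x. f x) (MAX x. g x) \<le> (MAX x. max (f x) (g x))"
    by (simp add: MAX_least)
qed

lemma MAX_scale:
  fixes f :: "'a::finite \<Rightarrow> real"
  assumes "0 \<le> c"
  shows "(MAX x. c * f x) = c * (MAX x. f x)"
proof (rule antisym)
  show "(MAX x. c * f x) \<le> c * (MAX x. f x)"
    by (rule MAX_least) (intro mult_left_mono MAX_upper assms)
next
  obtain x where "(MAX x. f x) = f x" by (rule MAX_attained)
  then show "c * (MAX x. f x) \<le> (MAX x. c * f x)"
    using MAX_upper[of "\<lambda>x. c * f x" x] by simp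
qed

lemma MAX_reindex:
  fixes f :: "'b::finite \<Rightarrow> real" and h :: "'a::finite \<Rightarrow> 'b"
  assumes "surj h"
  shows "(MAX x. f (h x)) = (MAX y. f y)"
  using assms by (metis image_image)

lemma MAX_pairs:
  fixes f :: "'a::finite \<Rightarrow> 'b::finite \<Rightarrow> real"
  shows "(MAX i. MAX j. f i j) = (MAX (i, j). f i j)"
proof (rule antisym)
  have "f i j \<le> (MAX (i, j). f i j)" for i j
    using MAX_upper[of "\<lambda>(i, j). f i j" "(i, j)"] by simp
  then show "(MAX i. MAX j. f i j) \<le> (MAX (i, j). f i j)"
    by (intro MAX_least)
next
  have "f i j \<le> (MAX i. MAX j. f i j)" for i j
    using MAX_upper[of "f i" j] MAX_upper[of "\<lambda>i. MAX j. f i j" i] by linarith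
  then show "(MAX (i, j). f i j) \<le> (MAX i. MAX j. f i j)"
    by (auto intro: MAX_least)
qed

text \<open>The value \<open>0\<close> outside a single index is absorbed because \<open>0\<close> is neutral for the maximum on
  nonnegative numbers; this is how multiplication by a permutation matrix selects an entry.\<close>

lemma MAX_single:
  fixes f :: "'a::finite \<Rightarrow> real"
  assumes "0 \<le> f a"
  shows "(MAX x. if x = a then f x else 0) = f a"
proof (rule antisym)
  show "(MAX x. if x = a then f x else 0) \<le> f a"
    using assms by (intro MAX_least) simp
  show "f a \<le> (MAX x. if x = a then f x else 0)"
    using MAX_upper[of "\<lambda>x. if x = a then f x else 0" a] by simp
qed

section \<open>Unitary matrices of max algebra are permutation matrices\<close>

definition perm_mat :: "('n \<Rightarrow> 'n) \<Rightarrow> real ^ 'n ^ 'n" where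
  "perm_mat p = (\<chi> k i. if k = p i then 1 else 0)"

lemma perm_mat_nonneg: "perm_mat p \<in> nonneg_mats"
  by (simp add: perm_mat_def nonneg_mats_def)

lemma transpose_nonneg: "A \<in> nonneg_mats \<Longrightarrow> transpose A \<in> nonneg_mats"
  by (simp add: nonneg_mats_def transpose_def)

lemma transpose_perm_mat:
  assumes "bij p"
  shows "transpose (perm_mat p) = perm_mat (inv p)"
  using assms
  by (auto simp: perm_mat_def transpose_def vec_eq_iff bij_is_inj bij_is_surj surj_f_inv_f)

lemma max_mult_perm_mat:
  assumes "A \<in> nonneg_mats"
  shows "(A \<otimes>\<^sub>m perm_mat p) $ i $ j = A $ i $ p j"
proof -
  have "(A \<otimes>\<^sub>m perm_mat p) $ i $ j = (MAX l. if l = p j then A $ i $ l else 0)"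
    by (simp add: max_mult_def perm_mat_def if_distrib cong: if_cong)
  also have "\<dots> = A $ i $ p j"
    using assms by (intro MAX_single) (simp add: nonneg_mats_def)
  finally show ?thesis .
qed

lemma transpose_perm_mat_max_mult:
  assumes "A \<in> nonneg_mats"
  shows "(transpose (perm_mat p) \<otimes>\<^sub>m A) $ i $ j = A $ p i $ j"
proof -
  have "(transpose (perm_mat p) \<otimes>\<^sub>m A) $ i $ j = (MAX l. if l = p i then A $ l $ j else 0)"
    by (simp add: max_mult_def perm_mat_def transpose_def if_distrib[of "\<lambda>x. x * _"] cong: if_cong)
  also have "\<dots> = A $ p i $ j"
    using assms by (intro MAX_single) (simp add: nonneg_mats_def)
  finally show ?thesis .
qed

lemma perm_mat_max_unitary:
  fixes p :: "'n::finite \<Rightarrow> 'n"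
  assumes "bij p"
  shows "perm_mat p \<in> max_unitary"
proof -
  have cancel: "transpose (perm_mat q) \<otimes>\<^sub>m perm_mat q = mat 1" if "bij q" for q :: "'n \<Rightarrow> 'n"
    unfolding vec_eq_iff transpose_perm_mat_max_mult[OF perm_mat_nonneg]
    using that by (simp add: perm_mat_def mat_def bij_is_inj inj_eq)
  have "perm_mat p \<otimes>\<^sub>m transpose (perm_mat p) = mat 1"
    using cancel[of "inv p"] assms by (simp add: transpose_perm_mat[symmetric] bij_imp_bij_inv)
  with cancel[OF assms] show ?thesis
    by (simp add: max_unitary_def perm_mat_nonneg)
qed

text \<open>Column \<open>i\<close> contains a \<open>1\<close> because the maximum of its squares is \<open>1\<close>; its other entries vanish
  because distinct rows have max product \<open>0\<close>, which bounds each product of two entries.\<close>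

lemma max_unitary_imp_perm_mat:
  assumes "U \<in> max_unitary"
  obtains p where "bij p" "U = perm_mat p"
proof -
  have nonneg: "0 \<le> U $ i $ j" for i j
    using assms by (simp add: max_unitary_def nonneg_mats_def)
  have columns: "(MAX k. U $ k $ i * U $ k $ j) = (if i = j then 1 else 0)" for i j
    using assms by (auto simp: max_unitary_def max_mult_def transpose_def mat_def vec_eq_iff)
  have rows: "(MAX k. U $ i $ k * U $ j $ k) = (if i = j then 1 else 0)" for i j
    using assms by (auto simp: max_unitary_def max_mult_def transpose_def mat_def vec_eq_iff)
  have "\<exists>k. U $ k $ i = 1" for i
  proof -
    obtain k where "(MAX k. U $ k $ i * U $ k $ i) = U $ k $ i * U $ k $ i"
      by (rule MAX_attained)
    then have "(U $ k $ i)\<^sup>2 = 1" by (simp add: columns power2_eq_square)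
    then show ?thesis using nonneg[of k i] by (auto simp: power2_eq_1_iff)
  qed
  then obtain p where one: "\<And>i. U $ p i $ i = 1" by metis
  have zero: "U $ k $ i = 0" if "k \<noteq> p i" for k i
    using MAX_upper[of "\<lambda>i. U $ k $ i * U $ p i $ i" i]
      MAX_upper[of "\<lambda>l. U $ k $ l * U $ p i $ l" i] nonneg[of k i] that
    by (simp add: rows one)
  have "inj p"
  proof (rule injI, rule ccontr)
    fix i j assume "p i = p j" "i \<noteq> j"
    then show False
      using MAX_upper[of "\<lambda>k. U $ k $ i * U $ k $ j" "p i"] one[of i] one[of j]
      by (simp add: columns)
  qed
  then have "bij p" by (simp add: bij_def finite_UNIV_inj_surj)
  moreover have "U = perm_mat p"
    using one zero by (auto simp: perm_mat_def vec_eq_iff)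
  ultimately show ?thesis by (rule that)
qed

section \<open>The numerical range as a set of relabelled pairings\<close>

definition perm_pairing :: "real ^ 'n ^ 'n \<Rightarrow> real ^ 'n ^ 'n \<Rightarrow> ('n \<Rightarrow> 'n) \<Rightarrow> real" where
  "perm_pairing C A p = (MAX (i, j). C $ i $ j * A $ p j $ p i)"

lemma max_mult_nonneg:
  assumes "A \<in> nonneg_mats" "B \<in> nonneg_mats"
  shows "A \<otimes>\<^sub>m B \<in> nonneg_mats"
proof -
  have "0 \<le> (MAX l. A $ i $ l * B $ l $ j)" for i j
    by (rule order_trans[OF _ MAX_upper]) (use assms in \<open>simp add: nonneg_mats_def\<close>)
  then show ?thesis by (simp add: max_mult_def nonneg_mats_def)
qed

lemma max_tr_conj_perm_mat:
  assumes A: "A \<in> nonneg_mats" and C: "C \<in> nonneg_mats" and p: "bij p"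
  shows "max_tr (C \<otimes>\<^sub>m transpose (perm_mat p) \<otimes>\<^sub>m A \<otimes>\<^sub>m perm_mat p) = perm_pairing C A p"
proof -
  let ?P = "perm_mat p"
  have left: "(C \<otimes>\<^sub>m transpose ?P) $ i $ l = C $ i $ inv p l" for i l
    by (simp add: transpose_perm_mat[OF p] max_mult_perm_mat[OF C])
  have middle: "(C \<otimes>\<^sub>m transpose ?P \<otimes>\<^sub>m A) $ i $ k = (MAX j. C $ i $ j * A $ p j $ k)" for i k
  proof -
    have "(C \<otimes>\<^sub>m transpose ?P \<otimes>\<^sub>m A) $ i $ k = (MAX l. C $ i $ inv p l * A $ l $ k)"
      by (subst max_mult_def) (simp add: left)
    also have "\<dots> = (MAX j. C $ i $ inv p (p j) * A $ p j $ k)"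
      using MAX_reindex[OF bij_is_surj[OF p], of "\<lambda>l. C $ i $ inv p l * A $ l $ k"] by simp
    finally show ?thesis by (simp add: inv_f_f[OF bij_is_inj[OF p]])
  qed
  have "C \<otimes>\<^sub>m transpose ?P \<otimes>\<^sub>m A \<in> nonneg_mats"
    by (intro max_mult_nonneg transpose_nonneg perm_mat_nonneg A C)
  then show ?thesis
    by (simp add: max_tr_def max_mult_perm_mat middle MAX_pairs perm_pairing_def)
qed

lemma max_num_range_eq_perm_pairing:
  fixes A C :: "real ^ 'n ^ 'n"
  assumes "A \<in> nonneg_mats" "C \<in> nonneg_mats"
  shows "max_num_range C A = perm_pairing C A ` {p. bij p}"
proof -
  have unitary: "max_unitary = perm_mat ` {p :: 'n \<Rightarrow> 'n. bij p}"
    using perm_mat_max_unitary max_unitary_imp_perm_mat by blast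
  have "max_num_range C A =
      (\<lambda>p. max_tr (C \<otimes>\<^sub>m transpose (perm_mat p) \<otimes>\<^sub>m A \<otimes>\<^sub>m perm_mat p)) ` {p. bij p}"
    unfolding max_num_range_def Setcompr_eq_image unitary image_image ..
  also have "\<dots> = perm_pairing C A ` {p. bij p}"
    by (intro image_cong refl) (simp add: max_tr_conj_perm_mat assms)
  finally show ?thesis .
qed

section \<open>Rules for the pairing\<close>

lemma perm_pairing_max_add:
  assumes "C \<in> nonneg_mats"
  shows "perm_pairing C (A \<oplus>\<^sub>m B) p = max (perm_pairing C A p) (perm_pairing C B p)"
proof -
  have "C $ i $ j * max x y = max (C $ i $ j * x) (C $ i $ j * y)" for i j x y
    using assms by (simp add: nonneg_mats_def max_mult_distrib_left)
  then show ?thesis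
    by (simp add: perm_pairing_def max_add_def MAX_max[symmetric] case_prod_unfold)
qed

lemma perm_pairing_scaleR:
  assumes "0 \<le> c"
  shows "perm_pairing C (c *\<^sub>R A) p = c * perm_pairing C A p"
  using MAX_scale[OF assms, of "\<lambda>(i, j). C $ i $ j * A $ p j $ p i"]
  by (simp add: perm_pairing_def case_prod_unfold mult.left_commute)

text \<open>The identity matrix is invariant under relabelling, so only the entries \<open>i = j\<close> survive.\<close>

lemma perm_pairing_mat_1:
  assumes "C \<in> nonneg_mats" "bij p"
  shows "perm_pairing C (mat 1) p = max_tr C"
proof -
  have "(MAX j. C $ i $ j * mat 1 $ p j $ p i) = C $ i $ i" for i
  proof -
    have "(MAX j. C $ i $ j * mat 1 $ p j $ p i) = (MAX j. if j = i then C $ i $ j else 0)"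
      using assms(2) by (simp add: mat_def bij_is_inj inj_eq if_distrib cong: if_cong)
    then show ?thesis
      using assms(1) MAX_single[of "\<lambda>j. C $ i $ j" i] by (simp add: nonneg_mats_def)
  qed
  then show ?thesis by (simp add: perm_pairing_def max_tr_def MAX_pairs[symmetric])
qed

lemma perm_pairing_transpose:
  "perm_pairing (transpose C) (transpose A) p = perm_pairing C A p"
  using MAX_reindex[OF surj_swap, of "\<lambda>(i, j). C $ i $ j * A $ p j $ p i"]
  by (simp add: perm_pairing_def transpose_def case_prod_unfold)

lemma perm_pairing_conj:
  assumes "A \<in> nonneg_mats"
  shows "perm_pairing C (transpose (perm_mat q) \<otimes>\<^sub>m A \<otimes>\<^sub>m perm_mat q) p = perm_pairing C A (q \<circ> p)"
  using assms
  by (simp add: perm_pairing_def max_mult_perm_mat transpose_perm_mat_max_mult max_mult_nonneg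
      transpose_nonneg perm_mat_nonneg)

text \<open>Substituting \<open>(i, j) = (p l, p k)\<close> moves the relabelling from one matrix to the other.\<close>

lemma perm_pairing_inv:
  assumes "bij p"
  shows "perm_pairing A C (inv p) = perm_pairing C A p"
proof -
  have "surj (\<lambda>(k, l). (p l, p k))"
    by (rule surjI[where f = "\<lambda>(i, j). (inv p j, inv p i)"])
      (use bij_is_surj[OF assms] in \<open>auto simp: surj_f_inv_f\<close>)
  from MAX_reindex[OF this, of "\<lambda>(i, j). A $ i $ j * C $ inv p j $ inv p i"] show ?thesis
    by (simp add: perm_pairing_def case_prod_unfold inv_f_f[OF bij_is_inj[OF assms]] mult.commute)
qed

section \<open>Rules for the numerical range\<close>

lemma max_add_nonneg: "A \<in> nonneg_mats \<Longrightarrow> A \<oplus>\<^sub>m B \<in> nonneg_mats"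
  by (auto simp: nonneg_mats_def max_add_def le_max_iff_disj)

lemma scaleR_nonneg: "0 \<le> c \<Longrightarrow> A \<in> nonneg_mats \<Longrightarrow> c *\<^sub>R A \<in> nonneg_mats"
  by (simp add: nonneg_mats_def)

lemma max_num_range_affine:
  assumes "A \<in> nonneg_mats" "C \<in> nonneg_mats" "0 \<le> \<alpha>" "0 \<le> \<beta>"
  shows "max_num_range C (\<alpha> *\<^sub>R A \<oplus>\<^sub>m \<beta> *\<^sub>R mat 1) =
    set_max_scalar (set_scale \<alpha> (max_num_range C A)) (\<beta> * max_tr C)"
proof -
  have "perm_pairing C (\<alpha> *\<^sub>R A \<oplus>\<^sub>m \<beta> *\<^sub>R mat 1) p =
      max (\<alpha> * perm_pairing C A p) (\<beta> * max_tr C)" if "bij p" for p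
    using that assms by (simp add: perm_pairing_max_add perm_pairing_scaleR perm_pairing_mat_1)
  then have "max_num_range C (\<alpha> *\<^sub>R A \<oplus>\<^sub>m \<beta> *\<^sub>R mat 1) =
      (\<lambda>p. max (\<alpha> * perm_pairing C A p) (\<beta> * max_tr C)) ` {p. bij p}"
    using assms by (simp add: max_num_range_eq_perm_pairing max_add_nonneg scaleR_nonneg)
  then show ?thesis
    unfolding max_num_range_eq_perm_pairing[OF assms(1,2)] set_max_scalar_def set_scale_def by blast
qed

lemma max_num_range_commute:
  fixes A C :: "real ^ 'n ^ 'n"
  assumes "A \<in> nonneg_mats" "C \<in> nonneg_mats"
  shows "max_num_range C A = max_num_range A C"
proof -
  have "perm_pairing C A ` {p. bij p} \<subseteq> perm_pairing A C ` {p. bij p}" for A C :: "real ^ 'n ^ 'n"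
  proof (rule image_subsetI)
    fix p :: "'n \<Rightarrow> 'n" assume "p \<in> {p. bij p}"
    then show "perm_pairing C A p \<in> perm_pairing A C ` {p. bij p}"
      by (intro image_eqI[of _ _ "inv p"]) (simp_all add: perm_pairing_inv bij_imp_bij_inv)
  qed
  then show ?thesis
    unfolding max_num_range_eq_perm_pairing[OF assms] max_num_range_eq_perm_pairing[OF assms(2,1)]
    by (intro antisym)
qed

lemma max_num_range_max_add_subset:
  assumes "A \<in> nonneg_mats" "B \<in> nonneg_mats" "C \<in> nonneg_mats"
  shows "max_num_range C (A \<oplus>\<^sub>m B) \<subseteq> set_max (max_num_range C A) (max_num_range C B)"
  using assms
  by (auto simp: max_num_range_eq_perm_pairing max_add_nonneg perm_pairing_max_add set_max_def)

lemma max_num_range_conj: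
  fixes A C :: "real ^ 'n ^ 'n"
  assumes "A \<in> nonneg_mats" "C \<in> nonneg_mats" "U \<in> max_unitary"
  shows "max_num_range C (transpose U \<otimes>\<^sub>m A \<otimes>\<^sub>m U) = max_num_range C A"
proof -
  obtain q where q: "bij q" and U: "U = perm_mat q"
    using assms(3) by (rule max_unitary_imp_perm_mat)
  have "(\<circ>) q ` {p :: 'n \<Rightarrow> 'n. bij p} = {p. bij p}"
  proof
    show "{p :: 'n \<Rightarrow> 'n. bij p} \<subseteq> (\<circ>) q ` {p. bij p}"
    proof
      fix p :: "'n \<Rightarrow> 'n" assume "p \<in> {p. bij p}"
      then have "bij (inv q \<circ> p)" using q by (simp add: bij_comp bij_imp_bij_inv)
      moreover have "p = q \<circ> (inv q \<circ> p)"
        using bij_is_surj[OF q] by (simp add: fun_eq_iff surj_f_inv_f)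
      ultimately show "p \<in> (\<circ>) q ` {p. bij p}" by blast
    qed
  qed (use q in \<open>auto intro: bij_comp\<close>)
  then have "(\<lambda>p. perm_pairing C A (q \<circ> p)) ` {p. bij p} = perm_pairing C A ` {p. bij p}"
    by (metis image_image)
  then show ?thesis
    using assms(1,2)
    by (simp add: U max_num_range_eq_perm_pairing max_mult_nonneg transpose_nonneg perm_mat_nonneg
        perm_pairing_conj)
qed

lemma max_num_range_transpose:
  assumes "A \<in> nonneg_mats" "C \<in> nonneg_mats"
  shows "max_num_range (transpose C) (transpose A) = max_num_range C A"
  using assms by (simp add: max_num_range_eq_perm_pairing transpose_nonneg perm_pairing_transpose)

lemma max_num_range_scalar:
  fixes A :: "real ^ 'n ^ 'n"
  assumes "A \<in> nonneg_mats" "0 \<le> \<alpha>"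
  shows "max_num_range (\<alpha> *\<^sub>R mat 1) A = {\<alpha> * max_tr A}"
proof -
  have scalar: "\<alpha> *\<^sub>R mat 1 \<in> nonneg_mats"
    using assms(2) by (simp add: nonneg_mats_def mat_def)
  have "perm_pairing A (\<alpha> *\<^sub>R mat 1) p = \<alpha> * max_tr A" if "bij p" for p
    using that assms by (simp add: perm_pairing_scaleR perm_pairing_mat_1)
  then have "max_num_range A (\<alpha> *\<^sub>R mat 1) = (\<lambda>p. \<alpha> * max_tr A) ` {p :: 'n \<Rightarrow> 'n. bij p}"
    unfolding max_num_range_eq_perm_pairing[OF scalar assms(1)] by (intro image_cong refl) simp
  also have "\<dots> = {\<alpha> * max_tr A}" using bij_id by blast
  finally show ?thesis by (simp only: max_num_range_commute[OF assms(1) scalar])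
qed

theorem theorem4p2:
  fixes A C :: "real ^ 'n ^ 'n"
  assumes "A \<in> nonneg_mats" and "C \<in> nonneg_mats"
  shows
    "(\<forall>\<alpha> \<beta> :: real. 0 \<le> \<alpha> \<longrightarrow> 0 \<le> \<beta> \<longrightarrow>
        max_num_range C (\<alpha> *\<^sub>R A \<oplus>\<^sub>m \<beta> *\<^sub>R mat 1) =
        set_max_scalar (set_scale \<alpha> (max_num_range C A)) (\<beta> * max_tr C)) \<and>
     (\<forall>B \<in> nonneg_mats. \<forall>D \<in> nonneg_mats.
        max_num_range C (A \<oplus>\<^sub>m B) \<subseteq> set_max (max_num_range C A) (max_num_range C B) \<and>
        max_num_range (C \<oplus>\<^sub>m D) A \<subseteq> set_max (max_num_range C A) (max_num_range D A)) \<and>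
     (\<forall>U \<in> max_unitary.
        max_num_range C (transpose U \<otimes>\<^sub>m A \<otimes>\<^sub>m U) = max_num_range C A) \<and>
     (transpose C = C \<longrightarrow> max_num_range C (transpose A) = max_num_range C A) \<and>
     (\<forall>\<alpha> :: real. 0 \<le> \<alpha> \<longrightarrow> C = \<alpha> *\<^sub>R mat 1 \<longrightarrow>
        max_num_range C A = {\<alpha> * max_tr A}) \<and>
     max_num_range C A = max_num_range A C"
proof (intro conjI allI ballI impI)
  fix B D :: "real ^ 'n ^ 'n"
  assume B: "B \<in> nonneg_mats" and D: "D \<in> nonneg_mats"
  show "max_num_range C (A \<oplus>\<^sub>m B) \<subseteq> set_max (max_num_range C A) (max_num_range C B)"
    by (rule max_num_range_max_add_subset[OF assms(1) B assms(2)])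
  show "max_num_range (C \<oplus>\<^sub>m D) A \<subseteq> set_max (max_num_range C A) (max_num_range D A)"
    using max_num_range_max_add_subset[OF assms(2) D assms(1)]
    unfolding max_num_range_commute[OF assms] max_num_range_commute[OF assms(1) D]
      max_num_range_commute[OF assms(1) max_add_nonneg[OF assms(2)]] .
next
  assume "transpose C = C"
  then show "max_num_range C (transpose A) = max_num_range C A"
    using max_num_range_transpose[OF assms] by simp
next
  fix \<alpha> \<beta> :: real
  assume "0 \<le> \<alpha>" "0 \<le> \<beta>"
  then show "max_num_range C (\<alpha> *\<^sub>R A \<oplus>\<^sub>m \<beta> *\<^sub>R mat 1) =
      set_max_scalar (set_scale \<alpha> (max_num_range C A)) (\<beta> * max_tr C)"
    by (rule max_num_range_affine[OF assms])
next
  fix U :: "real ^ 'n ^ 'n"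
  assume "U \<in> max_unitary"
  then show "max_num_range C (transpose U \<otimes>\<^sub>m A \<otimes>\<^sub>m U) = max_num_range C A"
    by (rule max_num_range_conj[OF assms])
next
  fix \<alpha> :: real
  assume "0 \<le> \<alpha>" "C = \<alpha> *\<^sub>R mat 1"
  then show "max_num_range C A = {\<alpha> * max_tr A}"
    by (simp add: max_num_range_scalar[OF assms(1)])
next
  show "max_num_range C A = max_num_range A C"
    by (rule max_num_range_commute[OF assms])
qed

end
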